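(* Let $\mathcal{A} \in \mathbb{R}^{n_1\times\cdots\times n_d}$ be an order-$d$ real tensor. Suppose $\sigma$ is a nonzero singular value of $\mathcal{A}$ with unit modal singular vectors $u_1\in\mathbb{R}^{n_1},\ldots,u_d\in\mathbb{R}^{n_d}$. Then for every choice of signs $\alpha = [\alpha_1,\ldots,\alpha_d] = [1,\pm 1,\ldots,\pm 1]$ (that is, $\alpha_1 = 1$ and $\alpha_k\in\{1,-1\}$ for $k=2,\ldots,d$), the vector $$x_\alpha = \frac{1}{\sqrt d}\begin{bmatrix}\alpha_1 u_1\\ \alpha_2 u_2\\ \vdots\\ \alpha_d u_d\end{bmatrix}\in\mathbb{R}^{N},\qquad N=n_1+\cdots+n_d,$$ is an eigenvector of the symmetric tensor $\mathbf{sym}(\mathcal{A})\in\mathbb{R}^{N\times\cdots\times N}$ corresponding to the eigenvalue $$\lambda_\alpha = \alpha_1\alpha_2\cdots\alpha_d\,\frac{d!}{\sqrt{d^{d}}}\,\sigma .$$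
   Context: An order-$d$ tensor $\mathcal{A}\in\mathbb{R}^{n_1\times\cdots\times n_d}$ is a real $d$-dimensional array with entries $\mathcal{A}(\mathbf{i})=\mathcal{A}(i_1,\ldots,i_d)$, $1\le i_k\le n_k$. Transposition: for a permutation $\mathbf{p}=[p_1,\ldots,p_d]$ of $1,\ldots,d$, $\mathcal{A}^{<\mathbf{p}>}\in\mathbb{R}^{n_{p_1}\times\cdots\times n_{p_d}}$ is defined by $\mathcal{A}^{<\mathbf{p}>}(j_{p_1},\ldots,j_{p_d})=\mathcal{A}(j_1,\ldots,j_d)$ for $1\le j_k\le n_k$. Symmetric embedding: let $N=n_1+\cdots+n_d$ and partition the index range $1,\ldots,N$ into consecutive ranges $\mathbf{r}_1,\ldots,\mathbf{r}_d$ with $\mathbf{r}_k = (1+n_1+\cdots+n_{k-1}),\ldots,(n_1+\cdots+n_k)$. Then $\mathcal{C}=\mathbf{sym}(\mathcal{A})$ is the order-$d$ tensor in $\mathbb{R}^{N\times\cdots\times N}$ whose blocks $\mathcal{C}_{\mathbf{i}}=\mathcal{C}(\mathbf{r}_{i_1},\ldots,\mathbf{r}_{i_d})$, $1\le i_k\le d$, are $\mathcal{C}_{\mathbf{i}}=\mathcal{A}^{<\mathbf{i}>}$ if $\mathbf{i}=[i_1,\ldots,i_d]$ is a permutation of $1,\ldots,d$, and $\mathcal{C}_{\mathbf{i}}=0$ otherwise. This tensor is symmetric (invariant under every transposition). Modal unfolding: for index vectors $\mathbf{i},\mathbf{s}$ of length $e$, $ivec(\mathbf{i},\mathbf{s})=i_1+(i_2-1)s_1+\cdots+(i_e-1)(s_1\cdots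 s_{e-1})$. The mode-$k$ unfolding $\mathcal{A}_{(k)}$ is the matrix with $n_k$ rows and $\prod_{j\ne k}n_j$ columns given by $\mathcal{A}_{(k)}(i_k,ivec(\tilde{\mathbf{i}},\tilde{\mathbf{n}}))=\mathcal{A}(\mathbf{i})$, where $\tilde{\mathbf{i}},\tilde{\mathbf{n}}$ are $\mathbf{i}=[i_1,\ldots,i_d]$, $\mathbf{n}=[n_1,\ldots,n_d]$ with the $k$-th entry deleted. For vectors $u_k\in\mathbb{R}^{n_k}$, set $\tilde u_k = u_d\otimes\cdots\otimes u_{k+1}\otimes u_{k-1}\otimes\cdots\otimes u_1$ (Kronecker product), and $x^{\otimes m}$ denotes the $m$-fold Kronecker product $x\otimes\cdots\otimes x$. Singular value: $\sigma\in\mathbb{R}$ is a singular value of $\mathcal{A}$ with (mode-$k$) singular vectors $u_k$ if the $u_k\in\mathbb{R}^{n_k}$ are unit vectors (in the 2-norm) with $\mathcal{A}_{(k)}\tilde u_k=\sigma u_k$ for all $k=1,\ldots,d$. Eigenvalue: for a symmetric order-$d$ tensor $\mathcal{C}\in\mathbb{R}^{N\times\cdots\times N}$, a unit vector $x\in\mathbb{R}^N$ is an eigenvector with eigenvalue $\lambda$ if $\mathcal{C}_{(1)}x^{\otimes(d-1)}=\lambda x$. *)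

theory Defs
  imports
    "Jordan_Normal_Form.Matrix"
    "HOL-Combinatorics.Multiset_Permutations"
begin

text \<open>
  Conventions: every index (of a mode, of a coordinate, of a block, of a permutation) starts at
  \<open>0\<close>, as for the library's lists, vectors and matrices. A permutation of the modes is the list
  \<open>[p 0, ..., p (d - 1)]\<close> of its values, an element of \<open>permutations_of_set {..<d}\<close>.
\<close>

definition index_set :: "nat list \<Rightarrow> nat list set" where
  "index_set n = {i. list_all2 (<) i n}"

text \<open>A tensor is a dimension list with an array that carries no information outside its range.\<close>

typedef tensor = "SIGMA n:(UNIV :: nat list set).
    (extensional (index_set n) :: (nat list \<Rightarrow> real) set)"
proof
  show "([], \<lambda>_. undefined) \<in> (SIGMA n:UNIV. extensional (index_set n))"
    by (auto simp: extensional_def)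
qed

definition dims :: "tensor \<Rightarrow> nat list" where
  "dims A = fst (Rep_tensor A)"

definition entry :: "tensor \<Rightarrow> nat list \<Rightarrow> real" where
  "entry A = snd (Rep_tensor A)"

definition tensor :: "nat list \<Rightarrow> (nat list \<Rightarrow> real) \<Rightarrow> tensor" where
  "tensor n f = Abs_tensor (n, restrict f (index_set n))"

definition tensor_order :: "tensor \<Rightarrow> nat" where
  "tensor_order A = length (dims A)"

definition carrier_tensor :: "nat list \<Rightarrow> tensor set" where
  "carrier_tensor n = {A. dims A = n}"

lemma dims_tensor [simp]: "dims (tensor n f) = n"
  by (simp add: dims_def tensor_def Abs_tensor_inverse)

lemma entry_tensor [simp]: "i \<in> index_set n \<Longrightarrow> entry (tensor n f) i = f i"
  by (simp add: entry_def tensor_def Abs_tensor_inverse)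

lemma tensor_eqI:
  assumes "dims A = dims B" "\<And>i. i \<in> index_set (dims A) \<Longrightarrow> entry A i = entry B i"
  shows "A = B"
proof -
  have "snd (Rep_tensor A) \<in> extensional (index_set (dims A))"
       "snd (Rep_tensor B) \<in> extensional (index_set (dims B))"
    using Rep_tensor[of A] Rep_tensor[of B] by (auto simp: dims_def)
  then have "snd (Rep_tensor A) = snd (Rep_tensor B)"
    using assms by (auto simp: entry_def intro: extensionalityI)
  then show ?thesis
    using assms(1) by (simp add: dims_def Rep_tensor_inject[symmetric] prod_eq_iff)
qed

lemma index_set_iff: "i \<in> index_set n \<longleftrightarrow> length i = length n \<and> (\<forall>k<length n. i ! k < n ! k)"
  by (auto simp: index_set_def list_all2_conv_all_nth)


subsection \<open>Transposition and symmetry\<close>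

text \<open>
  For a permutation \<open>p\<close>, the list \<open>map ((!) j) p\<close> is \<open>[j (p 0), ..., j (p (d - 1))]\<close>, so the
  description operator recovers \<open>j\<close> from it; see \<open>entry_transposition\<close>.
\<close>

definition transposition :: "tensor \<Rightarrow> nat list \<Rightarrow> tensor" where
  "transposition A p = tensor (map ((!) (dims A)) p)
     (\<lambda>i. entry A (THE j. j \<in> index_set (dims A) \<and> map ((!) j) p = i))"

lemma entry_transposition:
  assumes p: "p \<in> permutations_of_set {..<tensor_order A}" and j: "j \<in> index_set (dims A)"
  shows "entry (transposition A p) (map ((!) j) p) = entry A j"
proof -
  have set_p: "set p = {..<length (dims A)}"
    using p by (auto simp: permutations_of_set_def tensor_order_def)
  have "map ((!) j) p \<in> index_set (map ((!) (dims A)) p)"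
    using j set_p by (auto simp: index_set_iff)
  moreover have "(THE j'. j' \<in> index_set (dims A) \<and> map ((!) j') p = map ((!) j) p) = j"
  proof (rule the_equality)
    fix j' assume *: "j' \<in> index_set (dims A) \<and> map ((!) j') p = map ((!) j) p"
    then have "\<forall>k<length (dims A). j' ! k = j ! k"
      using set_p by auto
    then show "j' = j"
      using * j by (intro nth_equalityI) (auto simp: index_set_iff)
  qed (use j in auto)
  ultimately show ?thesis
    by (simp add: transposition_def)
qed

definition symmetric_tensor :: "tensor \<Rightarrow> bool" where
  "symmetric_tensor C \<longleftrightarrow>
     (\<forall>p \<in> permutations_of_set {..<tensor_order C}. transposition C p = C)"


subsection \<open>The symmetric embedding\<close>

definition block_start :: "nat list \<Rightarrow> nat \<Rightarrow> nat" where
  "block_start n k = sum_list (take k n)"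

definition block_of :: "nat list \<Rightarrow> nat \<Rightarrow> nat" where
  "block_of n r = (THE k. k < length n \<and> block_start n k \<le> r \<and> r < block_start n (Suc k))"

definition offset_of :: "nat list \<Rightarrow> nat \<Rightarrow> nat" where
  "offset_of n r = r - block_start n (block_of n r)"

definition sym_embedding :: "tensor \<Rightarrow> tensor" where
  "sym_embedding A = (let n = dims A; d = length n in
     tensor (replicate d (sum_list n))
       (\<lambda>r. let b = map (block_of n) r in
          if b \<in> permutations_of_set {..<d}
          then entry (transposition A b) (map (offset_of n) r) else 0))"

text \<open>The block of \<open>C\<close> with block index \<open>b\<close>, for the partition of each index range given by \<open>n\<close>.\<close>

definition tensor_block :: "nat list \<Rightarrow> tensor \<Rightarrow> nat list \<Rightarrow> tensor" where
  "tensor_block n C b =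
     tensor (map ((!) n) b) (\<lambda>i. entry C (map2 (\<lambda>k j. block_start n k + j) b i))"

lemma block_start_Suc: "k < length n \<Longrightarrow> block_start n (Suc k) = block_start n k + n ! k"
  by (simp add: block_start_def take_Suc_conv_app_nth)

lemma block_start_mono: "k \<le> l \<Longrightarrow> block_start n k \<le> block_start n l"
  unfolding block_start_def
  by (metis le_add1 le_add_diff_inverse sum_list_append take_add)

lemma block_of_block_start:
  assumes "k < length n" "j < n ! k"
  shows "block_of n (block_start n k + j) = k"
  unfolding block_of_def
proof (rule the_equality)
  fix l assume l: "l < length n \<and> block_start n l \<le> block_start n k + j \<and>
    block_start n k + j < block_start n (Suc l)"
  show "l = k"
  proof (rule ccontr)
    assume "l \<noteq> k"
    then consider "Suc l \<le> k" | "Suc k \<le> l" by linarith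
    then show False
      using l assms block_start_mono[of "Suc l" k n] block_start_mono[of "Suc k" l n]
        block_start_Suc[of k n] by cases auto
  qed
qed (use assms block_start_Suc[of k n] in auto)

lemma tensor_block_sym_embedding:
  assumes b: "length b = tensor_order A" "set b \<subseteq> {..<tensor_order A}"
  shows "tensor_block (dims A) (sym_embedding A) b =
    (if b \<in> permutations_of_set {..<tensor_order A} then transposition A b
     else tensor (map ((!) (dims A)) b) (\<lambda>_. 0))"
proof (rule tensor_eqI)
  define n where "n = dims A"
  fix i assume "i \<in> index_set (dims (tensor_block (dims A) (sym_embedding A) b))"
  then have i: "i \<in> index_set (map ((!) n) b)"
    by (simp add: tensor_block_def n_def)
  define r where "r = map2 (\<lambda>k j. block_start n k + j) b i"
  have len: "length i = length b" "length b = length n"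
    using i b by (auto simp: index_set_iff tensor_order_def n_def)
  have bi: "b ! m < length n" "i ! m < n ! (b ! m)" if "m < length n" for m
    using i b that len by (auto simp: index_set_iff tensor_order_def n_def set_conv_nth)
  have blocks: "map (block_of n) r = b" and offsets: "map (offset_of n) r = i"
    using bi len
    by (auto simp: r_def offset_of_def block_of_block_start intro!: nth_equalityI)
  have "r ! m < sum_list n" if "m < length n" for m
  proof -
    have "r ! m < block_start n (Suc (b ! m))"
      using that bi len by (simp add: r_def block_start_Suc)
    also have "\<dots> \<le> block_start n (length n)"
      using bi[OF that] by (intro block_start_mono) auto
    finally show ?thesis by (simp add: block_start_def)
  qed
  then have "r \<in> index_set (replicate (length n) (sum_list n))"
    using len by (simp add: index_set_iff r_def)
  then show "entry (tensor_block (dims A) (sym_embedding A) b) i = entry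
      (if b \<in> permutations_of_set {..<tensor_order A} then transposition A b
       else tensor (map ((!) (dims A)) b) (\<lambda>_. 0)) i"
    using i blocks offsets
    by (simp add: tensor_block_def sym_embedding_def Let_def tensor_order_def
        flip: n_def r_def)
qed (simp add: tensor_block_def transposition_def)


subsection \<open>Modal unfoldings\<close>

definition delete_nth :: "nat \<Rightarrow> 'a list \<Rightarrow> 'a list" where
  "delete_nth k xs = take k xs @ drop (Suc k) xs"

text \<open>
  With indices counted from \<open>0\<close>, the formula \<open>i_1 + (i_2 - 1) s_1 + (i_3 - 1) s_1 s_2 + ...\<close>,
  itself shifted to start at \<open>0\<close>, becomes the following sum; the first index varies fastest.
\<close>

definition ivec :: "nat list \<Rightarrow> nat list \<Rightarrow> nat" where
  "ivec i s = (\<Sum>m<length i. i ! m * prod_list (take m s))"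

definition unfolding_mat :: "nat \<Rightarrow> tensor \<Rightarrow> real mat" where
  "unfolding_mat k A = (let n = dims A in
     mat (n ! k) (prod_list (delete_nth k n))
       (\<lambda>(r, c). entry A (THE i. i \<in> index_set n \<and> i ! k = r \<and>
          ivec (delete_nth k i) (delete_nth k n) = c)))"

lemma ivec_Cons: "ivec (i # is) (s # ss) = i + s * ivec is ss"
  by (simp add: ivec_def sum.lessThan_Suc_shift sum_distrib_left mult_ac del: sum.lessThan_Suc)

lemma ivec_less: "list_all2 (<) i s \<Longrightarrow> ivec i s < prod_list s"
proof (induction rule: list_all2_induct)
  case (Cons i "is" s ss)
  have "i + s * ivec is ss < s + s * ivec is ss" using Cons by simp
  also have "\<dots> = s * Suc (ivec is ss)" by simp
  also have "\<dots> \<le> s * prod_list ss" using Cons by (intro mult_left_mono) auto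
  finally show ?case by (simp add: ivec_Cons)
qed (simp add: ivec_def)

lemma ivec_inj:
  "list_all2 (<) i s \<Longrightarrow> list_all2 (<) j s \<Longrightarrow> ivec i s = ivec j s \<Longrightarrow> i = j"
proof (induction i s arbitrary: j rule: list_all2_induct)
  case (Cons i "is" s ss)
  then obtain j0 js where j: "j = j0 # js" "j0 < s" "list_all2 (<) js ss"
    by (auto simp: list_all2_Cons2)
  have eq: "i + s * ivec is ss = j0 + s * ivec js ss"
    using Cons.prems by (simp add: j ivec_Cons)
  have "i = j0"
    using arg_cong[OF eq, of "\<lambda>x. x mod s"] Cons.hyps j by simp
  moreover have "ivec is ss = ivec js ss"
    using eq \<open>i = j0\<close> j by simp
  ultimately show ?case
    using Cons.IH j by simp
qed simp

lemma unfolding_mat_index: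
  assumes k: "k < tensor_order A" and i: "i \<in> index_set (dims A)"
  shows "unfolding_mat k A $$ (i ! k, ivec (delete_nth k i) (delete_nth k (dims A))) = entry A i"
proof -
  define n where "n = dims A"
  have del: "list_all2 (<) (delete_nth k j) (delete_nth k n)" if "j \<in> index_set n" for j
    using that unfolding index_set_def delete_nth_def
    by (auto intro!: list_all2_appendI list_all2_takeI list_all2_dropI)
  have "(THE j. j \<in> index_set n \<and> j ! k = i ! k \<and>
      ivec (delete_nth k j) (delete_nth k n) = ivec (delete_nth k i) (delete_nth k n)) = i"
  proof (rule the_equality)
    fix j assume j: "j \<in> index_set n \<and> j ! k = i ! k \<and>
      ivec (delete_nth k j) (delete_nth k n) = ivec (delete_nth k i) (delete_nth k n)"
    have len: "length i = length n" "length j = length n" "k < length n"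
      using i j k by (auto simp: index_set_iff n_def tensor_order_def)
    have "delete_nth k j = delete_nth k i"
      using j i del by (intro ivec_inj[of _ "delete_nth k n"]) (auto simp: n_def)
    then have "take k j = take k i" "drop (Suc k) j = drop (Suc k) i"
      using len by (auto simp: delete_nth_def)
    then show "j = i"
      using len j id_take_nth_drop[of k j] id_take_nth_drop[of k i] by simp
  qed (use i n_def in auto)
  moreover have "i ! k < n ! k"
    using i k by (auto simp: index_set_iff n_def tensor_order_def)
  moreover have "ivec (delete_nth k i) (delete_nth k n) < prod_list (delete_nth k n)"
    using i by (intro ivec_less del) (simp add: n_def)
  ultimately show ?thesis
    by (simp add: unfolding_mat_def Let_def flip: n_def)
qed


subsection \<open>Kronecker products, singular values and eigenvalues\<close>

definition kron :: "real vec \<Rightarrow> real vec \<Rightarrow> real vec" (infixr \<open>\<otimes>\<^sub>v\<close> 70) where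
  "u \<otimes>\<^sub>v v = vec (dim_vec u * dim_vec v) (\<lambda>i. u $ (i div dim_vec v) * v $ (i mod dim_vec v))"

definition kron_list :: "real vec list \<Rightarrow> real vec" where
  "kron_list us = foldr (\<otimes>\<^sub>v) us (vec 1 (\<lambda>_. 1))"

definition kron_power :: "real vec \<Rightarrow> nat \<Rightarrow> real vec" where
  "kron_power x m = kron_list (replicate m x)"

text \<open>The product of all vectors but the one at position \<open>k\<close>, in descending order of position.\<close>

definition kron_except :: "nat \<Rightarrow> real vec list \<Rightarrow> real vec" where
  "kron_except k us = kron_list (rev (delete_nth k us))"

definition unit_vec2 :: "real vec \<Rightarrow> bool" where
  "unit_vec2 v \<longleftrightarrow> sqrt (v \<bullet> v) = 1"

definition singular_value_with :: "tensor \<Rightarrow> real \<Rightarrow> real vec list \<Rightarrow> bool" where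
  "singular_value_with A \<sigma> us \<longleftrightarrow>
     length us = tensor_order A \<and>
     (\<forall>k<tensor_order A.
        us ! k \<in> carrier_vec (dims A ! k) \<and> unit_vec2 (us ! k) \<and>
        unfolding_mat k A *\<^sub>v kron_except k us = \<sigma> \<cdot>\<^sub>v (us ! k))"

text \<open>Eigenvalues are defined for symmetric tensors only, so symmetry of \<open>C\<close> is part of the notion.\<close>

definition eigenvalue_with :: "nat \<Rightarrow> nat \<Rightarrow> tensor \<Rightarrow> real \<Rightarrow> real vec \<Rightarrow> bool" where
  "eigenvalue_with d N C ev x \<longleftrightarrow>
     C \<in> carrier_tensor (replicate d N) \<and> symmetric_tensor C \<and>
     x \<in> carrier_vec N \<and> unit_vec2 x \<and>
     unfolding_mat 0 C *\<^sub>v kron_power x (d - 1) = ev \<cdot>\<^sub>v x"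

definition stack :: "real vec list \<Rightarrow> real vec" where
  "stack vs = foldr (@\<^sub>v) vs (0\<^sub>v 0)"

end

theory Submission
  imports Defs
begin

section \<open>Unfoldings as multilinear forms\<close>

text \<open>Write \<open>C\<close> for the embedding, \<open>d\<close> for the order and
  \<open>s\<close> for 1/sqrt(d). Multiplying the first unfolding of \<open>C\<close> by the
  Kronecker power of \<open>x\<close> contracts \<open>C\<close> with \<open>x\<close> in every mode
  but the first. A row lies in some block \<beta> at some offset \<open>j\<close>, and its value is
  a sum over the indices of \<open>C\<close> with that first coordinate. Nonzero terms occur only in
  blocks whose block index is a permutation starting with \<beta>. There are (d-1)! of these, and
  each is a transposed copy of the array \<open>A\<close>. Since all contracted modes receive the
  same vector \<open>x\<close>, reordering the factors shows that every copy contributes the same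
  number: the contraction of \<open>A\<close>, in all modes but \<beta>, with the blocks of
  \<open>x\<close>.

  These blocks are s \<alpha>_k u_k. By multilinearity the factor s^(d-1) and the product of the
  signs \<alpha>_k with k \<noteq> \<beta> come out, and the singular vector equation in mode
  \<beta> leaves \<sigma> u_\<beta>(j). Because \<alpha>_\<beta> squares to 1, the product of the
  remaining signs is the full product times \<alpha>_\<beta>. So the row equals (d-1)! s^(d-2)
  \<sigma> times the full sign product times the entry of \<open>x\<close>, and d s^2 = 1 turns
  (d-1)! s^(d-2) into d! s^d = d!/sqrt(d^d).

  The contraction formula is \<open>index_unfolding_mat_mult_kron_except\<close>, applied both to
  \<open>A\<close> in mode \<beta> and to \<open>C\<close> in the first mode. The count over
  permutation blocks is \<open>sum_sym_embedding\<close>, which rests on the parametrization of the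
  nonzero positions of \<open>C\<close> by \<open>embed_index\<close>. Symmetry of \<open>C\<close>,
  a part of the eigenvalue notion, is \<open>symmetric_tensor_sym_embedding\<close>.\<close>

lemma ivec_surj: "c < prod_list s \<Longrightarrow> \<exists>i\<in>index_set s. ivec i s = c"
proof (induction s arbitrary: c)
  case Nil
  then show ?case by (auto simp: index_set_def ivec_def)
next
  case (Cons s ss)
  then have "s > 0" by (cases s) auto
  then have "c div s < prod_list ss"
    using Cons.prems by (simp add: less_mult_imp_div_less mult.commute)
  with Cons.IH obtain i where "i \<in> index_set ss" "ivec i ss = c div s" by blast
  with \<open>s > 0\<close> show ?case
    \<comment> \<open>Mixed radix digits: the first index varies fastest, so it is the remainder,
      and the quotient encodes the rest.\<close>
    by (intro bexI[of _ "(c mod s) # i"]) (auto simp: ivec_Cons index_set_def)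
qed

lemma bij_betw_ivec: "bij_betw (\<lambda>i. ivec i s) (index_set s) {..<prod_list s}"
proof (rule bij_betw_imageI)
  show "inj_on (\<lambda>i. ivec i s) (index_set s)"
    using ivec_inj[of _ s] by (auto simp: index_set_def inj_on_def)
  show "(\<lambda>i. ivec i s) ` index_set s = {..<prod_list s}"
    using ivec_less[of _ s] ivec_surj[of _ s] by (force simp: index_set_def)
qed

lemma length_delete_nth: "k < length xs \<Longrightarrow> length (delete_nth k xs) = length xs - 1"
  by (simp add: delete_nth_def)

lemma nth_delete_nth:
  assumes "k < length xs" "m < length xs - 1"
  shows "delete_nth k xs ! m = xs ! (if m < k then m else Suc m)"
  using assms by (auto simp: delete_nth_def nth_append)

lemma map_delete_nth: "map f (delete_nth k xs) = delete_nth k (map f xs)"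
  by (simp add: delete_nth_def take_map drop_map)

text \<open>Together with \<open>bij_betw_ivec\<close>, this lets a sum over the columns in row
  \<open>r\<close> of an unfolding run over the index vectors with \<open>k\<close>-th entry
  \<open>r\<close>. The inverse reinserts \<open>r\<close> at position \<open>k\<close>.\<close>

lemma bij_betw_delete_nth:
  assumes k: "k < length n" and r: "r < n ! k"
  shows "bij_betw (delete_nth k) {i \<in> index_set n. i ! k = r} (index_set (delete_nth k n))"
proof (rule bij_betwI[where g = "\<lambda>j. take k j @ r # drop k j"])
  show "delete_nth k \<in> {i \<in> index_set n. i ! k = r} \<rightarrow> index_set (delete_nth k n)"
    by (auto simp: index_set_def delete_nth_def
        intro!: list_all2_appendI list_all2_takeI list_all2_dropI)
next
  have "take k j @ r # drop k j \<in> index_set n" if "j \<in> index_set (delete_nth k n)" for j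
  proof -
    have "\<exists>us vs. j = us @ vs \<and> list_all2 (<) us (take k n) \<and> list_all2 (<) vs (drop (Suc k) n)"
      using that unfolding index_set_def delete_nth_def list_all2_append2 by auto
    then obtain us vs where
      j: "j = us @ vs" "list_all2 (<) us (take k n)" "list_all2 (<) vs (drop (Suc k) n)"
      by blast
    then have "length us = k" using k by (auto dest: list_all2_lengthD)
    moreover have "list_all2 (<) (us @ r # vs) (take k n @ n ! k # drop (Suc k) n)"
      using j r by (intro list_all2_appendI) auto
    ultimately show ?thesis
      using k j by (simp add: index_set_def id_take_nth_drop[symmetric])
  qed
  then show "(\<lambda>j. take k j @ r # drop k j)
      \<in> index_set (delete_nth k n) \<rightarrow> {i \<in> index_set n. i ! k = r}"
    using k by (auto simp: index_set_iff length_delete_nth nth_append)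
next
  fix i assume "i \<in> {i \<in> index_set n. i ! k = r}"
  then show "take k (delete_nth k i) @ r # drop k (delete_nth k i) = i"
    using k id_take_nth_drop[of k i] by (auto simp: index_set_iff delete_nth_def)
next
  fix j assume "j \<in> index_set (delete_nth k n)"
  then show "delete_nth k (take k j @ r # drop k j) = j"
    using k by (auto simp: index_set_iff delete_nth_def min_def)
qed

section \<open>Kronecker products and their entries\<close>

lemma dim_vec_kron [simp]: "dim_vec (u \<otimes>\<^sub>v v) = dim_vec u * dim_vec v"
  by (simp add: kron_def)

lemma index_kron:
  "i < dim_vec u * dim_vec v \<Longrightarrow> (u \<otimes>\<^sub>v v) $ i = u $ (i div dim_vec v) * v $ (i mod dim_vec v)"
  by (simp add: kron_def)

lemma mult_add_div_eq: "(i::nat) < a \<Longrightarrow> (i + a * c) div a = c"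
  by simp

text \<open>\<open>kron_list\<close> nests to the right, whereas the reversal in
  \<open>kron_except\<close> puts the head of a list last. Associativity allows that last factor to
  be split off, as in \<open>kron_list_snoc\<close>.\<close>

lemma kron_assoc: "(u \<otimes>\<^sub>v v) \<otimes>\<^sub>v w = u \<otimes>\<^sub>v (v \<otimes>\<^sub>v w)"
proof (rule eq_vecI)
  fix i assume "i < dim_vec (u \<otimes>\<^sub>v (v \<otimes>\<^sub>v w))"
  then have i: "i < dim_vec u * (dim_vec v * dim_vec w)" by simp
  then have pos: "dim_vec w > 0" "dim_vec v > 0" by (auto intro: Nat.gr0I)
  \<comment> \<open>Both bracketings read the same three mixed radix digits of \<open>i\<close>;
    here the two lower ones are separated.\<close>
  have mod_eq: "i mod (dim_vec v * dim_vec w)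
      = i mod dim_vec w + dim_vec w * (i div dim_vec w mod dim_vec v)"
    using mod_mult2_eq[of i "dim_vec w" "dim_vec v"] by (simp add: mult.commute add.commute)
  have "i div dim_vec w < dim_vec u * dim_vec v"
    using i by (intro less_mult_imp_div_less) (simp add: mult_ac)
  moreover have "i mod (dim_vec v * dim_vec w) < dim_vec v * dim_vec w"
    using pos by simp
  moreover have "i div (dim_vec v * dim_vec w) = i div dim_vec w div dim_vec v"
    by (metis div_mult2_eq mult.commute)
  moreover have "i mod (dim_vec v * dim_vec w) div dim_vec w = i div dim_vec w mod dim_vec v"
    unfolding mod_eq using pos by (intro mult_add_div_eq) simp
  moreover have "i mod (dim_vec v * dim_vec w) mod dim_vec w = i mod dim_vec w"
    by (simp add: mod_mod_cancel)
  ultimately show "((u \<otimes>\<^sub>v v) \<otimes>\<^sub>v w) $ i = (u \<otimes>\<^sub>v (v \<otimes>\<^sub>v w)) $ i"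
    using i pos by (simp add: index_kron mult_ac)
qed (simp add: mult_ac)

lemma kron_list_Cons: "kron_list (u # us) = u \<otimes>\<^sub>v kron_list us"
  by (simp add: kron_list_def)

lemma kron_list_snoc: "kron_list (us @ [v]) = kron_list us \<otimes>\<^sub>v v"
proof (induction us)
  case Nil
  show ?case by (auto simp: kron_list_def index_kron intro!: eq_vecI)
qed (simp add: kron_list_Cons kron_assoc)

lemma dim_vec_kron_list [simp]: "dim_vec (kron_list us) = prod_list (map dim_vec us)"
  by (induction us) (simp_all add: kron_list_def)

text \<open>The last Kronecker factor has the fastest varying index, and so does the first
  coordinate in \<open>ivec\<close>. The descending order of the factors is therefore the one that
  matches the column numbering.\<close>

lemma index_kron_list_rev:
  "list_all2 (<) i (map dim_vec vs) \<Longrightarrow>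
    kron_list (rev vs) $ ivec i (map dim_vec vs) = (\<Prod>m<length vs. vs ! m $ (i ! m))"
proof (induction vs arbitrary: i)
  case Nil
  then show ?case by (simp add: kron_list_def ivec_def)
next
  case (Cons v vs)
  then obtain i0 js where i: "i = i0 # js" "i0 < dim_vec v" "list_all2 (<) js (map dim_vec vs)"
    by (auto simp: list_all2_Cons2)
  have "ivec i (map dim_vec (v # vs)) < dim_vec v * prod_list (map dim_vec vs)"
    using ivec_less[OF Cons.prems] by simp
  then show ?case
    using i Cons.IH[OF i(3)]
    by (simp add: kron_list_snoc ivec_Cons index_kron mult_add_div_eq prod.lessThan_Suc_shift
        rev_map[symmetric] mult_ac del: prod.lessThan_Suc)
qed

section \<open>Contraction in all modes but one\<close>

lemma bij_betw_skip:
  assumes "k < d"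
  shows "bij_betw (\<lambda>m. if m < k then m else Suc m) {..<d - 1} ({..<d} - {k})"
proof (rule bij_betwI[where g = "\<lambda>m. if m < k then m else m - 1"], goal_cases)
  case 1
  have "Suc m < d" if "m < d - 1" for m
    using that by linarith
  then show ?case using assms by (auto simp: Pi_iff)
next
  case 2
  have "m - 1 < d - 1" "k < d - 1" if "m < d" "m \<noteq> k" "\<not> m < k" for m
    using that by linarith+
  moreover have "m < d - 1" if "m < k" for m
    using that assms by linarith
  ultimately show ?case by (simp add: Pi_iff)
qed auto

text \<open>Removes the matrix encoding: column numbers are traded for index vectors, after which
  only a multilinear sum over the entries of \<open>A\<close> remains.\<close>

lemma index_unfolding_mat_mult_kron_except:
  assumes k: "k < tensor_order A" and vs: "length vs = tensor_order A"
    and dim: "\<forall>m<tensor_order A. vs ! m \<in> carrier_vec (dims A ! m)"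
    and r: "r < dims A ! k"
  shows "(unfolding_mat k A *\<^sub>v kron_except k vs) $ r =
    (\<Sum>i | i \<in> index_set (dims A) \<and> i ! k = r.
       entry A i * (\<Prod>m\<in>{..<tensor_order A} - {k}. vs ! m $ (i ! m)))"
proof -
  define n where "n = dims A"
  define P where "P = prod_list (delete_nth k n)"
  have len: "length n = tensor_order A" by (simp add: n_def tensor_order_def)
  have map_dim: "map dim_vec vs = n"
    using vs dim by (auto intro!: nth_equalityI simp: len) (auto simp: n_def)
  have map_dim': "map dim_vec (delete_nth k vs) = delete_nth k n"
    by (simp add: map_delete_nth map_dim)
  have dimM: "dim_row (unfolding_mat k A) = n ! k" "dim_col (unfolding_mat k A) = P"
    by (simp_all add: unfolding_mat_def Let_def n_def P_def)
  have dimK: "dim_vec (kron_except k vs) = P"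
    unfolding kron_except_def P_def dim_vec_kron_list
    by (simp add: map_dim' rev_map[symmetric])
  have bij: "bij_betw (\<lambda>i. ivec (delete_nth k i) (delete_nth k n))
      {i \<in> index_set n. i ! k = r} {..<P}"
    using bij_betw_trans[OF bij_betw_delete_nth[of k n r] bij_betw_ivec] k r len
    by (simp add: n_def P_def o_def)
  have "(unfolding_mat k A *\<^sub>v kron_except k vs) $ r =
      (\<Sum>c<P. unfolding_mat k A $$ (r, c) * kron_except k vs $ c)"
    using r by (simp add: dimM dimK scalar_prod_def lessThan_atLeast0 n_def[symmetric])
  also have "\<dots> = (\<Sum>i | i \<in> index_set n \<and> i ! k = r.
      unfolding_mat k A $$ (r, ivec (delete_nth k i) (delete_nth k n)) *
      kron_except k vs $ ivec (delete_nth k i) (delete_nth k n))"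
    by (rule sum.reindex_bij_betw[OF bij, symmetric])
  also have "\<dots> = (\<Sum>i | i \<in> index_set n \<and> i ! k = r.
       entry A i * (\<Prod>m\<in>{..<tensor_order A} - {k}. vs ! m $ (i ! m)))"
  proof (rule sum.cong[OF refl])
    fix i assume i: "i \<in> {i. i \<in> index_set n \<and> i ! k = r}"
    then have "list_all2 (<) (delete_nth k i) (map dim_vec (delete_nth k vs))"
      unfolding map_dim' unfolding index_set_def delete_nth_def
      by (auto intro!: list_all2_appendI list_all2_takeI list_all2_dropI)
    from index_kron_list_rev[OF this]
    have "kron_except k vs $ ivec (delete_nth k i) (delete_nth k n) =
        (\<Prod>m<tensor_order A - 1. delete_nth k vs ! m $ (delete_nth k i ! m))"
      using k vs by (simp add: kron_except_def map_dim' length_delete_nth)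
    also have "\<dots> = (\<Prod>m<tensor_order A - 1. vs ! (if m < k then m else Suc m) $
        (i ! (if m < k then m else Suc m)))"
      using i k vs len by (intro prod.cong) (auto simp: nth_delete_nth index_set_iff)
    also have "\<dots> = (\<Prod>m\<in>{..<tensor_order A} - {k}. vs ! m $ (i ! m))"
      by (rule prod.reindex_bij_betw[OF bij_betw_skip[OF k]])
    finally show "unfolding_mat k A $$ (r, ivec (delete_nth k i) (delete_nth k n)) *
        kron_except k vs $ ivec (delete_nth k i) (delete_nth k n) =
        entry A i * (\<Prod>m\<in>{..<tensor_order A} - {k}. vs ! m $ (i ! m))"
      using unfolding_mat_index[OF k, of i] i by (auto simp: n_def)
  qed
  finally show ?thesis by (simp add: n_def)
qed

text \<open>Makes the eigenvalue equation an instance of the contraction formula, with mode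
  \<open>0\<close> left out and all vectors equal.\<close>

lemma kron_power_eq_kron_except: "kron_power x (d - 1) = kron_except 0 (replicate d x)"
  by (cases d) (simp_all add: kron_power_def kron_except_def delete_nth_def)


section \<open>Entries of the symmetric embedding\<close>

text \<open>The position in the embedding at which block \<open>p\<close>, a transposed copy of
  \<open>A\<close>, holds the entry of \<open>A\<close> at \<open>i\<close>.\<close>

definition embed_index :: "nat list \<Rightarrow> nat list \<Rightarrow> nat list \<Rightarrow> nat list" where
  "embed_index n p i = map (\<lambda>k. block_start n k + i ! k) p"

lemma block_start_add_less:
  assumes "k < length n" "j < n ! k"
  shows "block_start n k + j < sum_list n"
proof -
  have "block_start n k + j < block_start n (Suc k)"
    using assms by (simp add: block_start_Suc)
  also have "\<dots> \<le> block_start n (length n)"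
    using assms by (intro block_start_mono) auto
  finally show ?thesis by (simp add: block_start_def)
qed

lemma block_start_decomp:
  "r < sum_list n \<Longrightarrow> \<exists>k<length n. \<exists>j<n ! k. r = block_start n k + j"
proof (induction n arbitrary: r)
  case (Cons a n)
  show ?case
  proof (cases "r < a")
    case True
    then show ?thesis by (intro exI[of _ 0]) (auto simp: block_start_def)
  next
    case False
    then have "r - a < sum_list n" using Cons.prems by auto
    with Cons.IH obtain k j where "k < length n" "j < n ! k" "r - a = block_start n k + j"
      by blast
    then show ?thesis
      using False by (intro exI[of _ "Suc k"]) (auto simp: block_start_def intro!: exI[of _ j])
  qed
qed simp

section \<open>Permutations as lists\<close>

lemma permutations_of_set_lessThan_iff:
  "p \<in> permutations_of_set {..<d} \<longleftrightarrow> set p = {..<d} \<and> length p = d"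
proof -
  have "distinct p \<longleftrightarrow> length p = d" if "set p = {..<d}"
    using distinct_card[of p] card_distinct[of p] unfolding that card_lessThan by metis
  then show ?thesis unfolding permutations_of_set_def mem_Collect_eq by metis
qed

lemma bij_betw_nth_permutation:
  assumes "p \<in> permutations_of_set {..<d}"
  shows "bij_betw ((!) p) {..<d} {..<d}"
proof (rule bij_betw_nth)
  show "distinct p" using assms by (rule permutations_of_setD)
qed (use assms in \<open>simp_all add: permutations_of_set_lessThan_iff\<close>)

lemma permutation_inverse:
  assumes "p \<in> permutations_of_set {..<d}"
  shows "\<exists>g. \<forall>m<d. g m < d \<and> g (p ! m) = m \<and> p ! g m = m"
proof (intro exI allI impI)
  note bij = bij_betw_nth_permutation[OF assms]
  fix m assume "m < d"
  then show "inv_into {..<d} ((!) p) m < d \<and> inv_into {..<d} ((!) p) (p ! m) = m \<and>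
      p ! inv_into {..<d} ((!) p) m = m"
    using bij_betw_apply[OF bij_betw_inv_into[OF bij], of m]
      bij_betw_inv_into_left[OF bij, of m] bij_betw_inv_into_right[OF bij, of m] by auto
qed

section \<open>Block coordinates of positions in the embedding\<close>

lemma block_of_less:
  assumes "r < sum_list n" shows "block_of n r < length n"
  using block_start_decomp[OF assms] by (auto simp: block_of_block_start)

lemma offset_of_less:
  assumes "r < sum_list n" shows "offset_of n r < n ! block_of n r"
  using block_start_decomp[OF assms] by (auto simp: offset_of_def block_of_block_start)

lemma block_start_add_offset:
  assumes "r < sum_list n" shows "block_start n (block_of n r) + offset_of n r = r"
  using block_start_decomp[OF assms] by (auto simp: offset_of_def block_of_block_start)

lemma embed_index_in_index_set:
  assumes "p \<in> permutations_of_set {..<length n}" "i \<in> index_set n"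
  shows "embed_index n p i \<in> index_set (replicate (length n) (sum_list n))"
  using assms by (auto simp: permutations_of_set_lessThan_iff index_set_iff embed_index_def
      intro!: block_start_add_less)

lemma map_block_of_embed_index:
  assumes "p \<in> permutations_of_set {..<length n}" "i \<in> index_set n"
  shows "map (block_of n) (embed_index n p i) = p"
  using assms by (auto simp: permutations_of_set_lessThan_iff index_set_iff embed_index_def
      block_of_block_start intro!: map_idI)

lemma map_offset_of_embed_index:
  assumes "p \<in> permutations_of_set {..<length n}" "i \<in> index_set n"
  shows "map (offset_of n) (embed_index n p i) = map ((!) i) p"
  using assms by (auto simp: permutations_of_set_lessThan_iff index_set_iff embed_index_def
      block_of_block_start offset_of_def)

text \<open>The blocks of the coordinates recover \<open>p\<close>; the offsets are then
  \<open>i\<close> read along \<open>p\<close>, which determines \<open>i\<close> because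
  \<open>p\<close> meets every mode.\<close>

lemma inj_on_embed_index:
  "inj_on (\<lambda>(p, i). embed_index n p i) (permutations_of_set {..<length n} \<times> index_set n)"
proof (rule inj_onI, clarify)
  fix p i q j
  assume p: "p \<in> permutations_of_set {..<length n}" "i \<in> index_set n"
    and q: "q \<in> permutations_of_set {..<length n}" "j \<in> index_set n"
    and eq: "embed_index n p i = embed_index n q j"
  have pq: "p = q"
    using map_block_of_embed_index[OF p] map_block_of_embed_index[OF q] eq by simp
  have "map ((!) i) p = map ((!) j) p"
    using map_offset_of_embed_index[OF p] map_offset_of_embed_index[OF q] eq pq by simp
  then have "i = j"
    using p q by (intro nth_equalityI) (auto simp: index_set_iff permutations_of_set_lessThan_iff)
  with pq show "p = q \<and> i = j" by simp
qed

lemma embed_index_exists: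
  assumes r: "r \<in> index_set (replicate (length n) (sum_list n))"
    and p: "map (block_of n) r \<in> permutations_of_set {..<length n}"
  shows "\<exists>i\<in>index_set n. r = embed_index n (map (block_of n) r) i"
proof -
  define b where "b = map (block_of n) r"
  have len: "length r = length n" and less: "\<And>m. m < length n \<Longrightarrow> r ! m < sum_list n"
    using r by (auto simp: index_set_iff)
  obtain g where g_less: "\<And>m. m < length n \<Longrightarrow> g m < length n"
    and g: "\<And>m. m < length n \<Longrightarrow> g (b ! m) = m" "\<And>m. m < length n \<Longrightarrow> b ! g m = m"
    using permutation_inverse[OF p] unfolding b_def by blast
  \<comment> \<open>Mode \<open>k\<close> is the block of the coordinate at position
    \<open>g k\<close> of \<open>r\<close>, so the offset there is the \<open>k\<close>-th
    coordinate sought.\<close>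
  define i where "i = map (\<lambda>k. offset_of n (r ! g k)) [0..<length n]"
  have bm: "b ! m = block_of n (r ! m)" if "m < length n" for m
    using that by (simp add: b_def len)
  have "i \<in> index_set n"
    using g(2) g_less less offset_of_less[of "r ! g m" n for m] bm
    by (auto simp: index_set_iff i_def) metis
  moreover have "r = embed_index n b i"
    using less g(1) len
    by (auto simp: embed_index_def i_def b_def block_of_less block_start_add_offset
        intro!: nth_equalityI)
  ultimately show ?thesis by (auto simp: b_def)
qed

lemma dims_sym_embedding: "dims (sym_embedding A) = replicate (tensor_order A) (sum_list (dims A))"
  by (simp add: sym_embedding_def Let_def tensor_order_def)

lemma tensor_order_sym_embedding: "tensor_order (sym_embedding A) = tensor_order A"
  by (simp add: tensor_order_def[of "sym_embedding A"] dims_sym_embedding)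

lemma entry_sym_embedding_embed_index:
  assumes "p \<in> permutations_of_set {..<tensor_order A}" "i \<in> index_set (dims A)"
  shows "entry (sym_embedding A) (embed_index (dims A) p i) = entry A i"
  using assms embed_index_in_index_set[of p "dims A" i] map_block_of_embed_index[of p "dims A" i]
    map_offset_of_embed_index[of p "dims A" i] entry_transposition[OF assms]
  by (simp add: sym_embedding_def Let_def tensor_order_def)

lemma entry_sym_embedding_eq_0:
  assumes "r \<in> index_set (dims (sym_embedding A))"
    "map (block_of (dims A)) r \<notin> permutations_of_set {..<tensor_order A}"
  shows "entry (sym_embedding A) r = 0"
  using assms by (simp add: sym_embedding_def Let_def tensor_order_def)

section \<open>Symmetry of the embedding\<close>

lemma permutations_of_set_map_nth:
  assumes p: "p \<in> permutations_of_set {..<d}" and b: "length b = d"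
  shows "map ((!) b) p \<in> permutations_of_set {..<d} \<longleftrightarrow> b \<in> permutations_of_set {..<d}"
proof -
  have "set p = {..<d}" "length p = d"
    using p by (auto simp: permutations_of_set_lessThan_iff)
  moreover have "(!) b ` {..<d} = set b"
    using b by (auto simp: in_set_conv_nth)
  ultimately show ?thesis using b by (simp add: permutations_of_set_lessThan_iff)
qed

text \<open>Reordering the coordinates of a position reorders its block index in the same way. Hence
  a permutation block goes to a permutation block showing the same entry of \<open>A\<close>, and
  zero blocks go to zero blocks.\<close>

lemma symmetric_tensor_sym_embedding: "symmetric_tensor (sym_embedding A)"
  unfolding symmetric_tensor_def
proof
  define n where "n = dims A"
  define C where "C = sym_embedding A"
  fix p assume "p \<in> permutations_of_set {..<tensor_order (sym_embedding A)}"
  then have p: "p \<in> permutations_of_set {..<length n}"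
    unfolding tensor_order_sym_embedding by (simp add: tensor_order_def n_def)
  have pC: "p \<in> permutations_of_set {..<tensor_order C}"
    using p unfolding C_def tensor_order_sym_embedding by (simp add: tensor_order_def n_def)
  have dC: "dims C = replicate (length n) (sum_list n)"
    by (simp add: C_def dims_sym_embedding n_def tensor_order_def)
  have p_less: "p ! m < length n" if "m < length n" for m
    using p that nth_mem[of m p] by (auto simp: permutations_of_set_lessThan_iff)
  have lenp: "length p = length n" and set_p: "set p = {..<length n}"
    using p by (simp_all add: permutations_of_set_lessThan_iff)
  show "transposition (sym_embedding A) p = sym_embedding A"
    unfolding C_def[symmetric]
  proof (rule tensor_eqI)
    show dims: "dims (transposition C p) = dims C"
      using p_less lenp by (auto simp: transposition_def dC intro!: nth_equalityI)
    fix r assume "r \<in> index_set (dims (transposition C p))"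
    then have r: "r \<in> index_set (dims C)" by (simp add: dims)
    obtain g where g_less: "\<And>m. m < length n \<Longrightarrow> g m < length n"
      and g: "\<And>m. m < length n \<Longrightarrow> g (p ! m) = m"
      using permutation_inverse[OF p] by blast
    \<comment> \<open>\<open>j\<close> is \<open>r\<close> rearranged by the inverse of
      \<open>p\<close>, so that reading \<open>j\<close> along \<open>p\<close> gives
      \<open>r\<close>, the form that \<open>entry_transposition\<close> evaluates.\<close>
    define j where "j = map (\<lambda>k. r ! g k) [0..<length n]"
    have r': "length r = length n" "\<And>m. m < length n \<Longrightarrow> r ! m < sum_list n"
      using r by (auto simp: index_set_iff dC)
    have j: "j \<in> index_set (dims C)"
      by (simp add: index_set_iff dC j_def g_less r')
    have rj: "r = map ((!) j) p"
    proof (rule nth_equalityI)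
      fix m assume "m < length r"
      then have "m < length n" by (simp add: r')
      then show "r ! m = map ((!) j) p ! m"
        by (simp add: lenp p_less j_def g)
    qed (simp add: lenp r')
    have lenj: "length j = length n" using j by (auto simp: index_set_iff dC)
    have blocks: "map (block_of n) r = map ((!) (map (block_of n) j)) p"
      using set_p lenj by (simp add: rj)
    have "entry C (map ((!) j) p) = entry C j"
    proof (cases "map (block_of n) j \<in> permutations_of_set {..<length n}")
      case True
      then obtain i where i: "i \<in> index_set n" "j = embed_index n (map (block_of n) j) i"
        using embed_index_exists[of j n] j by (auto simp: dC)
      define b where "b = map (block_of n) j"
      have b: "b \<in> permutations_of_set {..<length n}" using True by (simp add: b_def)
      have ji: "j = embed_index n b i" using i(2) by (simp add: b_def)
      have lenb: "length b = length n" by (simp add: b_def lenj)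
      have "map ((!) j) p = embed_index n (map ((!) b) p) i"
        using set_p lenb by (simp add: ji embed_index_def)
      moreover have "map ((!) b) p \<in> permutations_of_set {..<length n}"
        using permutations_of_set_map_nth[OF p lenb] b by simp
      ultimately show ?thesis
        using entry_sym_embedding_embed_index[of _ A i] b i
        by (simp add: ji C_def n_def tensor_order_def)
    next
      case False
      then have "map (block_of n) r \<notin> permutations_of_set {..<length n}"
        using permutations_of_set_map_nth[OF p, of "map (block_of n) j"] lenj blocks by simp
      then show ?thesis
        using entry_sym_embedding_eq_0[of r A] entry_sym_embedding_eq_0[of j A] False r j
        by (simp add: C_def rj n_def tensor_order_def)
    qed
    then show "entry (transposition C p) r = entry C r"
      using entry_transposition[OF pC j] by (simp add: rj)
  qed
qed

section \<open>Sums over a slice of the embedding\<close>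

lemma finite_index_set: "finite (index_set n)"
  using bij_betw_finite[OF bij_betw_ivec[of n]] by simp

text \<open>Behind the fixed head stands an arbitrary permutation of the other \<open>d - 1\<close>
  modes.\<close>

lemma card_permutations_of_set_hd:
  assumes "\<beta> < d"
  shows "card {p \<in> permutations_of_set {..<d}. p ! 0 = \<beta>} = fact (d - 1)"
proof -
  have "{p \<in> permutations_of_set {..<d}. p ! 0 = \<beta>} =
      (#) \<beta> ` permutations_of_set ({..<d} - {\<beta>})"
  proof -
    have "{..<d} \<noteq> {}" using assms by auto
    then show ?thesis using assms by (subst permutations_of_set_nonempty) auto
  qed
  then show ?thesis using assms by (simp add: card_image)
qed

text \<open>
  Only the blocks indexed by the permutations \<open>p\<close> with \<open>p ! 0 = \<beta>\<close> meet this slice, and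
  each of these \<open>(d - 1)!\<close> blocks contributes the same sum.
\<close>

lemma sum_sym_embedding:
  fixes f :: "nat \<Rightarrow> real"
  assumes \<beta>: "\<beta> < tensor_order A" and j: "j < dims A ! \<beta>"
  shows "(\<Sum>r | r \<in> index_set (dims (sym_embedding A)) \<and> r ! 0 = block_start (dims A) \<beta> + j.
      entry (sym_embedding A) r * (\<Prod>m\<in>{..<tensor_order A} - {0}. f (r ! m))) =
    fact (tensor_order A - 1) * (\<Sum>i | i \<in> index_set (dims A) \<and> i ! \<beta> = j.
      entry A i * (\<Prod>k\<in>{..<tensor_order A} - {\<beta>}. f (block_start (dims A) k + i ! k)))"
    (is "(\<Sum>r\<in>?R. ?g r) = _")
proof -
  define n where "n = dims A"
  define d where "d = tensor_order A"
  have len: "length n = d" by (simp add: n_def d_def tensor_order_def)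
  define Q where "Q = {p \<in> permutations_of_set {..<d}. p ! 0 = \<beta>}"
  define I where "I = {i. i \<in> index_set n \<and> i ! \<beta> = j}"
  let ?e = "\<lambda>(p, i). embed_index n p i"
  have dC: "dims (sym_embedding A) = replicate d (sum_list n)"
    by (simp add: dims_sym_embedding n_def d_def)
  have \<beta>d: "\<beta> < length n" "j < n ! \<beta>" 
    using \<beta> j unfolding len by (simp_all add: d_def n_def)
  have sub: "?e ` (Q \<times> I) \<subseteq> ?R"
  proof clarify
    fix p i assume pi: "p \<in> Q" "i \<in> I"
    then have "embed_index n p i ! 0 = block_start n \<beta> + j"
      using \<beta>d by (auto simp: embed_index_def Q_def I_def permutations_of_set_lessThan_iff len)
    then show "embed_index n p i \<in> index_set (dims (sym_embedding A)) \<and>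
        embed_index n p i ! 0 = block_start (dims A) \<beta> + j"
      using embed_index_in_index_set[of p n i, unfolded len] pi
      by (auto simp: Q_def I_def dC n_def)
  qed
  have zero: "?g r = 0" if r: "r \<in> ?R - ?e ` (Q \<times> I)" for r
  proof -
    \<comment> \<open>In a permutation block \<open>r\<close> would be an embedded position, and its
      first coordinate would force head \<beta> and \<open>\<beta>\<close>-th coordinate
      \<open>j\<close>, putting \<open>r\<close> into the image.\<close>
    have "map (block_of n) r \<notin> permutations_of_set {..<d}"
    proof
      assume b: "map (block_of n) r \<in> permutations_of_set {..<d}"
      then obtain i where i: "i \<in> index_set n" "r = embed_index n (map (block_of n) r) i"
        using embed_index_exists[of r n] r by (auto simp: dC len)
      have lenr: "length r = d" using r by (auto simp: index_set_iff dC)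
      have r0: "r ! 0 = block_start n \<beta> + j" using r by (auto simp: n_def)
      have b0: "map (block_of n) r ! 0 = \<beta>"
        using r0 \<beta>d lenr len by (simp add: block_of_block_start)
      have "r ! 0 = embed_index n (map (block_of n) r) i ! 0" using i(2) by simp
      also have "\<dots> = block_start n \<beta> + i ! \<beta>"
        using b0 lenr \<beta>d len by (simp add: embed_index_def)
      finally have "i ! \<beta> = j" using r0 by simp
      then have "(map (block_of n) r, i) \<in> Q \<times> I" using b b0 i by (simp add: Q_def I_def)
      then have "r \<in> ?e ` (Q \<times> I)" using i(2) by (metis case_prod_conv image_eqI)
      then show False using r by blast
    qed
    then show ?thesis
      using r entry_sym_embedding_eq_0[of r A] by (simp add: n_def d_def)
  qed
  have "finite ?R" using finite_index_set by simp
  then have "(\<Sum>r\<in>?R. ?g r) = (\<Sum>r\<in>?e ` (Q \<times> I). ?g r)"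
    using sub zero by (intro sum.mono_neutral_right) auto
  also have "\<dots> = (\<Sum>x\<in>Q \<times> I. ?g (?e x))"
    using inj_on_subset[OF inj_on_embed_index[of n], of "Q \<times> I"]
    by (subst sum.reindex) (auto simp: Q_def I_def len)
  also have "\<dots> = (\<Sum>x\<in>Q \<times> I. case x of (p, i) \<Rightarrow>
      entry A i * (\<Prod>k\<in>{..<d} - {\<beta>}. f (block_start n k + i ! k)))"
  proof (rule sum.cong[OF refl], clarify)
    fix p i assume pi: "p \<in> Q" "i \<in> I"
    then have p: "p \<in> permutations_of_set {..<d}" "p ! 0 = \<beta>" and i: "i \<in> index_set n"
      by (auto simp: Q_def I_def)
    have lenp: "length p = d" using p by (simp add: permutations_of_set_lessThan_iff)
    \<comment> \<open>As \<open>p\<close> sends \<open>0\<close> to \<beta>, it matches the other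
      positions with the other modes; reindexing the product along it removes every trace of
      \<open>p\<close>.\<close>
    have "bij_betw ((!) p) {..<d} {..<d}" using p by (intro bij_betw_nth_permutation)
    then have bij: "bij_betw ((!) p) ({..<d} - {0}) ({..<d} - {\<beta>})"
      using bij_betw_DiffI[of "(!) p" "{..<d}" "{..<d}" "{0}" "{\<beta>}"] p \<beta>d len by force
    have "(\<Prod>m\<in>{..<d} - {0}. f (embed_index n p i ! m)) =
        (\<Prod>m\<in>{..<d} - {0}. f (block_start n (p ! m) + i ! (p ! m)))"
      using lenp by (intro prod.cong) (auto simp: embed_index_def)
    also have "\<dots> = (\<Prod>k\<in>{..<d} - {\<beta>}. f (block_start n k + i ! k))"
      by (rule prod.reindex_bij_betw[OF bij])
    finally show "entry (sym_embedding A) (embed_index n p i) *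
        (\<Prod>m\<in>{..<tensor_order A} - {0}. f (embed_index n p i ! m)) =
        entry A i * (\<Prod>k\<in>{..<d} - {\<beta>}. f (block_start n k + i ! k))"
      using entry_sym_embedding_embed_index[of p A i] p i by (simp add: n_def d_def)
  qed
  \<comment> \<open>The summand depends on \<open>i\<close> alone, so summing over the permutations
    only multiplies by their number.\<close>
  also have "\<dots> = real (card Q) * (\<Sum>i\<in>I. entry A i *
      (\<Prod>k\<in>{..<d} - {\<beta>}. f (block_start n k + i ! k)))"
    by (simp add: sum.cartesian_product[symmetric])
  also have "card Q = fact (d - 1)"
    unfolding Q_def using \<beta>d len by (intro card_permutations_of_set_hd) simp
  finally show ?thesis by (simp add: I_def n_def d_def)
qed


section \<open>Stacked vectors and the eigenvalue equation\<close>

lemma stack_Cons: "stack (v # vs) = v @\<^sub>v stack vs"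
  by (simp add: stack_def)

lemma dim_vec_stack [simp]: "dim_vec (stack vs) = sum_list (map dim_vec vs)"
  by (induction vs) (simp_all add: stack_def)

lemma index_stack:
  "k < length vs \<Longrightarrow> j < dim_vec (vs ! k) \<Longrightarrow>
    stack vs $ (block_start (map dim_vec vs) k + j) = vs ! k $ j"
proof (induction vs arbitrary: k)
  case (Cons v vs)
  show ?case
  proof (cases k)
    case 0
    then show ?thesis using Cons.prems by (simp add: stack_Cons block_start_def)
  next
    case (Suc l)
    have "block_start (map dim_vec vs) l + j < sum_list (map dim_vec vs)"
      using Cons.prems Suc by (intro block_start_add_less) auto
    then show ?thesis
      using Cons Suc by (simp add: stack_Cons block_start_def)
  qed
qed simp

lemma scalar_prod_stack: "stack vs \<bullet> stack vs = (\<Sum>v\<leftarrow>vs. v \<bullet> v)"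
proof (induction vs)
  case (Cons v vs)
  have "(v @\<^sub>v stack vs) \<bullet> (v @\<^sub>v stack vs) = v \<bullet> v + stack vs \<bullet> stack vs"
    by (rule scalar_prod_append) (auto intro: carrier_vecI)
  then show ?case using Cons by (simp add: stack_Cons)
qed (simp add: stack_def)

theorem theorem4p7:
  fixes A :: tensor and d N :: nat and n :: "nat list" and \<sigma> :: real
    and u :: "real vec list" and \<alpha> :: "real list"
  assumes "d \<ge> 1" and "length n = d" and "N = sum_list n"
    and "A \<in> carrier_tensor n"
    and "singular_value_with A \<sigma> u" and "\<sigma> \<noteq> 0"
    and "length \<alpha> = d" and "\<alpha> ! 0 = 1" and "\<forall>k\<in>{1..<d}. \<alpha> ! k \<in> {1, -1}"
  shows "eigenvalue_with d N (sym_embedding A)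
           (prod_list \<alpha> * (fact d / sqrt (real d ^ d)) * \<sigma>)
           ((1 / sqrt (real d)) \<cdot>\<^sub>v stack (map2 (\<cdot>\<^sub>v) \<alpha> u))"
proof -
  define C where "C = sym_embedding A"
  define vs where "vs = map2 (\<cdot>\<^sub>v) \<alpha> u"
  define s where "s = 1 / sqrt (real d)"
  define x where "x = s \<cdot>\<^sub>v stack vs"
  have dimsA: "dims A = n" and order: "tensor_order A = d"
    using assms(2,4) by (auto simp: carrier_tensor_def tensor_order_def)
  have lenu: "length u = d"
    and u: "\<And>k. k < d \<Longrightarrow> dim_vec (u ! k) = n ! k" "\<And>k. k < d \<Longrightarrow> u ! k \<bullet> u ! k = 1"
      "\<And>k. k < d \<Longrightarrow> unfolding_mat k A *\<^sub>v kron_except k u = \<sigma> \<cdot>\<^sub>v (u ! k)"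
    using assms(5) by (auto simp: singular_value_with_def order dimsA unit_vec2_def)
  have sign: "\<alpha> ! k * \<alpha> ! k = 1" if "k < d" for k
  proof (cases "k = 0")
    case False
    then have "\<alpha> ! k = 1 \<or> \<alpha> ! k = -1" using assms(9) that by simp
    then show ?thesis by auto
  qed (simp add: assms(8))
  have lenvs: "length vs = d" using lenu assms(7) by (simp add: vs_def)
  have vs_nth: "vs ! k = \<alpha> ! k \<cdot>\<^sub>v u ! k" if "k < d" for k
    using that lenu assms(7) by (simp add: vs_def)
  have dim_vs: "map dim_vec vs = n"
    using lenvs assms(2) u(1) by (auto intro!: nth_equalityI simp: vs_nth)
  have x_dim: "dim_vec x = N" by (simp add: x_def dim_vs assms(3))
  have ss: "s * s = 1 / real d" by (simp add: s_def)
  \<comment> \<open>The signs square to 1 and the \<open>u ! k\<close> are unit vectors, so the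
    squared norm is \<open>d\<close>, which the factor \<open>s * s\<close> cancels.\<close>
  have "stack vs \<bullet> stack vs = (\<Sum>k<d. vs ! k \<bullet> vs ! k)"
    by (simp add: scalar_prod_stack sum_list_sum_nth lenvs lessThan_atLeast0)
  also have "\<dots> = (\<Sum>k<d. \<alpha> ! k * \<alpha> ! k * (u ! k \<bullet> u ! k))"
    by (intro sum.cong) (auto simp: vs_nth)
  also have "\<dots> = real d" by (simp add: u(2) sign)
  finally have "x \<bullet> x = 1" using assms(1) ss by (simp add: x_def flip: mult.assoc)
  then have unit: "unit_vec2 x" by (simp add: unit_vec2_def)
  have x_nth: "x $ (block_start n k + j) = s * \<alpha> ! k * (u ! k $ j)" if "k < d" "j < n ! k" for k j
    using that index_stack[of k vs j] block_start_add_less[of k n j] u(1) assms(2)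
    by (simp add: x_def dim_vs lenvs vs_nth)
  have dimsC: "dims C = replicate d N"
    by (simp add: C_def dims_sym_embedding order dimsA assms(3))
  have orderC: "tensor_order C = d" by (simp add: C_def tensor_order_sym_embedding order)
  define ev where "ev = prod_list \<alpha> * (fact d / sqrt (real d ^ d)) * \<sigma>"
  have "unfolding_mat 0 C *\<^sub>v kron_power x (d - 1) = ev \<cdot>\<^sub>v x"
  proof (rule eq_vecI)
    show "dim_vec (unfolding_mat 0 C *\<^sub>v kron_power x (d - 1)) = dim_vec (ev \<cdot>\<^sub>v x)"
      using assms(1) by (simp add: unfolding_mat_def Let_def dimsC x_dim)
    fix r assume "r < dim_vec (ev \<cdot>\<^sub>v x)"
    then have r: "r < N" by (simp add: x_dim)
    then obtain \<beta> j where \<beta>: "\<beta> < d" "j < n ! \<beta>" "r = block_start n \<beta> + j"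
      using block_start_decomp[of r n] assms(2,3) by auto
    \<comment> \<open>Preparation: the left side of the singular vector equation in mode \<beta>,
      the block containing row \<open>r\<close>, written as the sum to which the slice of
      \<open>C\<close> will reduce.\<close>
    have "\<forall>m<tensor_order A. u ! m \<in> carrier_vec (dims A ! m)"
      using u(1) by (auto simp: order dimsA intro!: carrier_vecI)
    from index_unfolding_mat_mult_kron_except[OF _ _ this, of \<beta> j]
    have row: "(unfolding_mat \<beta> A *\<^sub>v kron_except \<beta> u) $ j =
        (\<Sum>i | i \<in> index_set n \<and> i ! \<beta> = j.
          entry A i * (\<Prod>k\<in>{..<d} - {\<beta>}. u ! k $ (i ! k)))"
      using \<beta>(1,2) lenu by (simp add: order dimsA)
    have "(unfolding_mat 0 C *\<^sub>v kron_power x (d - 1)) $ r =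
      (\<Sum>i | i \<in> index_set (dims C) \<and> i ! 0 = block_start n \<beta> + j.
         entry C i * (\<Prod>m\<in>{..<d} - {0}. replicate d x ! m $ (i ! m)))"
      unfolding kron_power_eq_kron_except
      using index_unfolding_mat_mult_kron_except[of 0 C "replicate d x" r] assms(1) r \<beta>(3)
      by (simp add: orderC dimsC x_dim carrier_vecI)
    also have "\<dots> = (\<Sum>i | i \<in> index_set (dims C) \<and> i ! 0 = block_start n \<beta> + j.
         entry C i * (\<Prod>m\<in>{..<d} - {0}. x $ (i ! m)))"
      by (intro sum.cong arg_cong2[where f = "(*)"] prod.cong) auto
    also have "\<dots> = fact (d - 1) * (\<Sum>i | i \<in> index_set n \<and> i ! \<beta> = j.
        entry A i * (\<Prod>k\<in>{..<d} - {\<beta>}. x $ (block_start n k + i ! k)))"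
      using sum_sym_embedding[of \<beta> A j "($) x"] \<beta> by (simp add: C_def order dimsA)
    also have "(\<Sum>i | i \<in> index_set n \<and> i ! \<beta> = j.
        entry A i * (\<Prod>k\<in>{..<d} - {\<beta>}. x $ (block_start n k + i ! k))) =
        (\<Sum>i | i \<in> index_set n \<and> i ! \<beta> = j. s ^ (d - 1) * (\<Prod>k\<in>{..<d} - {\<beta>}. \<alpha> ! k) *
          (entry A i * (\<Prod>k\<in>{..<d} - {\<beta>}. u ! k $ (i ! k))))"
    proof (rule sum.cong[OF refl])
      fix i assume i: "i \<in> {i. i \<in> index_set n \<and> i ! \<beta> = j}"
      have "(\<Prod>k\<in>{..<d} - {\<beta>}. x $ (block_start n k + i ! k)) =
          (\<Prod>k\<in>{..<d} - {\<beta>}. s * \<alpha> ! k * (u ! k $ (i ! k)))"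
        using i assms(2) by (intro prod.cong) (auto simp: index_set_iff x_nth)
      also have "\<dots> = s ^ (d - 1) * (\<Prod>k\<in>{..<d} - {\<beta>}. \<alpha> ! k) *
          (\<Prod>k\<in>{..<d} - {\<beta>}. u ! k $ (i ! k))"
        using \<beta>(1) by (simp add: prod.distrib)
      finally show "entry A i * (\<Prod>k\<in>{..<d} - {\<beta>}. x $ (block_start n k + i ! k)) =
          s ^ (d - 1) * (\<Prod>k\<in>{..<d} - {\<beta>}. \<alpha> ! k) *
          (entry A i * (\<Prod>k\<in>{..<d} - {\<beta>}. u ! k $ (i ! k)))"
        by simp
    qed
    also have "\<dots> = s ^ (d - 1) * (\<Prod>k\<in>{..<d} - {\<beta>}. \<alpha> ! k) *
        (unfolding_mat \<beta> A *\<^sub>v kron_except \<beta> u) $ j"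
      unfolding row by (rule sum_distrib_left[symmetric])
    also have "\<dots> = s ^ (d - 1) * (\<Prod>k\<in>{..<d} - {\<beta>}. \<alpha> ! k) * (\<sigma> * u ! \<beta> $ j)"
      using \<beta> by (simp add: u)
    \<comment> \<open>A sign is its own inverse, so dividing the full product by
      \<open>\<alpha> ! \<beta>\<close> is multiplying by it; this restores the sign that the
      \<beta> block of \<open>x\<close> carries.\<close>
    also have "(\<Prod>k\<in>{..<d} - {\<beta>}. \<alpha> ! k) = prod_list \<alpha> * \<alpha> ! \<beta>"
    proof -
      have "prod_list \<alpha> = (\<Prod>k<d. \<alpha> ! k)"
        by (simp add: prod.list_conv_set_nth assms(7) lessThan_atLeast0)
      also have "\<dots> = \<alpha> ! \<beta> * (\<Prod>k\<in>{..<d} - {\<beta>}. \<alpha> ! k)"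
        using \<beta>(1) by (intro prod.remove) auto
      finally show ?thesis using sign[OF \<beta>(1)] by (simp add: mult_ac)
    qed
    also have "fact (d - 1) * (s ^ (d - 1) * (prod_list \<alpha> * \<alpha> ! \<beta>) * (\<sigma> * u ! \<beta> $ j)) =
        ev * (s * \<alpha> ! \<beta> * (u ! \<beta> $ j))"
    proof -
      obtain e where e: "d = Suc e" using assms(1) by (cases d) auto
      have "1 / sqrt (real d ^ d) = s ^ d"
        by (simp add: s_def real_sqrt_power power_one_over)
      \<comment> \<open>The entry of \<open>x\<close> contributes one more factor \<open>s\<close>;
        of the resulting \<open>d + 1\<close> factors, two cancel against the \<open>d\<close> split
        off from the factorial.\<close>
      then have "ev * s = prod_list \<alpha> * \<sigma> * (fact d * (s ^ d * s))"
        by (simp add: ev_def divide_inverse mult_ac)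
      also have "fact d * (s ^ d * s) = fact (d - 1) * s ^ (d - 1) * (real d * (s * s))"
        by (simp add: e algebra_simps)
      also have "real d * (s * s) = 1" using ss assms(1) by simp
      finally have "ev * s = prod_list \<alpha> * \<sigma> * (fact (d - 1) * s ^ (d - 1))" by simp
      then show ?thesis by (simp add: mult_ac)
    qed
    also have "\<dots> = (ev \<cdot>\<^sub>v x) $ r"
      using \<beta> r by (simp add: x_nth x_dim)
    finally show "(unfolding_mat 0 C *\<^sub>v kron_power x (d - 1)) $ r = (ev \<cdot>\<^sub>v x) $ r" .
  qed
  then show ?thesis
    unfolding eigenvalue_with_def
    using unit x_dim dimsC symmetric_tensor_sym_embedding[of A]
    by (auto simp: ev_def x_def s_def vs_def C_def carrier_tensor_def intro!: carrier_vecI)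
qed

end
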